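(* Let $\mathbf{G}$ be a spray on an $n$-dimensional manifold $M$. Suppose that $\mathbf{Ric}_{\mathbf{G}}=0$ and $\mathbf{S}_{(\mathbf{G},dV)}=(n+1)\phi_0$ for some volume form $dV$ and some scalar function $\phi$ on $M$, where $\phi_0=\phi_{x^m}y^m$. Then $\mathbf{G}$ is projectively Ricci-flat.
   Context: Let $M$ be an $n$-dimensional smooth manifold, $(x^i)$ local coordinates on $M$ and $(x^i,y^i)$ the induced coordinates on $TM$; repeated indices are summed. A spray $\mathbf{G}$ on $M$ is a smooth vector field on the slit tangent bundle $TM_0=TM\setminus\{0\}$ which in every standard local coordinate system has the form $\mathbf{G}=y^i\frac{\partial}{\partial x^i}-2G^i(x,y)\frac{\partial}{\partial y^i}$ with $G^i(x,\lambda y)=\lambda^2G^i(x,y)$ for all $\lambda>0$. Its Riemann curvature is $$R^i_{\ k}=2\frac{\partial G^i}{\partial x^k}-y^j\frac{\partial^2G^i}{\partial x^j\partial y^k}+2G^j\frac{\partial^2G^i}{\partial y^j\partial y^k}-\frac{\partial G^i}{\partial y^s}\frac{\partial G^s}{\partial y^k},$$ and its Ricci curvature is $\mathbf{Ric}_{\mathbf{G}}:=R^m_{\ m}$, a function on $TM_0$. A volume form on $M$ is written locally as $dV=\sigma(x)\,dx^1\cdots dx^n$ with $\sigma>0$ smooth. The S-curvature of $(\mathbf{G},dV)$ is the function on $TM_0$ given by $\mathbf{S}_{(\mathbf{G},dV)}:=\frac{\partial G^m}{\partial y^m}-y^m\frac{\partial}{\partial x^m}(\ln\sigma)$. The projective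 spray of $(\mathbf{G},dV)$ is $\hat{\mathbf{G}}:=\mathbf{G}+\frac{2\mathbf{S}}{n+1}\mathbf{Y}$ with $\mathbf{Y}=y^i\frac{\partial}{\partial y^i}$, i.e. $\hat G^i=G^i-\frac{\mathbf{S}}{n+1}y^i$. The projective Ricci curvature is $\mathbf{PRic}_{(\mathbf{G},dV)}:=\mathbf{Ric}_{\hat{\mathbf{G}}}$. The spray $\mathbf{G}$ is called projectively Ricci-flat if there is a volume form $dV$ on $M$ such that $\mathbf{PRic}_{(\mathbf{G},dV)}=0$. Scalar functions on $M$ are smooth functions of $x$ only. *)

theory Defs
  imports "HOL-Analysis.Analysis"
begin

subsection \<open>Smooth maps on open subsets of normed spaces\<close>

text \<open>The notions below are meant for an open set \<open>S\<close>; on such a set they only depend on the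
  values of \<open>f\<close> on \<open>S\<close>.\<close>

primrec Ck_on :: "nat \<Rightarrow> 'a::real_normed_vector set \<Rightarrow> ('a \<Rightarrow> 'b::real_normed_vector) \<Rightarrow> bool" where
  "Ck_on 0 S f \<longleftrightarrow> continuous_on S f"
| "Ck_on (Suc k) S f \<longleftrightarrow>
     (\<forall>x\<in>S. f differentiable (at x)) \<and> (\<forall>v. Ck_on k S (\<lambda>x. frechet_derivative f (at x) v))"

definition smooth_on :: "'a::real_normed_vector set \<Rightarrow> ('a \<Rightarrow> 'b::real_normed_vector) \<Rightarrow> bool" where
  "smooth_on S f \<longleftrightarrow> (\<forall>k. Ck_on k S f)"


subsection \<open>Smooth manifolds\<close>

text \<open>A chart is a pair of a domain and a coordinate map; the values of the coordinate map
  outside the domain are irrelevant.\<close>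

type_synonym ('m, 'e) chart = "'m set \<times> ('m \<Rightarrow> 'e)"

abbreviation chart_inv :: "('m, 'e) chart \<Rightarrow> 'e \<Rightarrow> 'm" where
  "chart_inv c \<equiv> inv_into (fst c) (snd c)"

abbreviation chart_image :: "('m, 'e) chart \<Rightarrow> 'e set" where
  "chart_image c \<equiv> snd c ` fst c"

definition is_chart :: "'m topology \<Rightarrow> ('m, 'e::euclidean_space) chart \<Rightarrow> bool" where
  "is_chart X c \<longleftrightarrow> openin X (fst c) \<and> open (chart_image c) \<and>
     homeomorphic_map (subtopology X (fst c)) (top_of_set (chart_image c)) (snd c)"

definition transition :: "('m, 'e) chart \<Rightarrow> ('m, 'f) chart \<Rightarrow> 'e \<Rightarrow> 'f" where
  "transition c c' = snd c' \<circ> chart_inv c"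

definition smoothly_compatible ::
  "('m, 'e::euclidean_space) chart \<Rightarrow> ('m, 'e) chart \<Rightarrow> bool" where
  "smoothly_compatible c c' \<longleftrightarrow>
     smooth_on (snd c ` (fst c \<inter> fst c')) (transition c c') \<and>
     smooth_on (snd c' ` (fst c \<inter> fst c')) (transition c' c)"

text \<open>The atlas is required to be maximal, so that quantifying over \<open>A\<close> is quantifying over all
  local coordinate systems of the smooth structure.\<close>

definition smooth_manifold :: "'m topology \<Rightarrow> ('m, 'e::euclidean_space) chart set \<Rightarrow> bool" where
  "smooth_manifold X A \<longleftrightarrow>
     Hausdorff_space X \<and> second_countable X \<and>
     (\<forall>c\<in>A. is_chart X c) \<and> \<Union> (fst ` A) = topspace X \<and>
     (\<forall>c\<in>A. \<forall>c'\<in>A. smoothly_compatible c c') \<and>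
     (\<forall>c. is_chart X c \<and> (\<forall>c'\<in>A. smoothly_compatible c c') \<longrightarrow> c \<in> A)"

definition smooth_scalar :: "('m, 'e::euclidean_space) chart set \<Rightarrow> ('m \<Rightarrow> real) \<Rightarrow> bool" where
  "smooth_scalar A f \<longleftrightarrow> (\<forall>c\<in>A. smooth_on (chart_image c) (f \<circ> chart_inv c))"

definition charts_at :: "('m, 'e) chart set \<Rightarrow> 'm \<Rightarrow> ('m, 'e) chart set" where
  "charts_at A p = {c \<in> A. p \<in> fst c}"

text \<open>Some chart around \<open>p\<close>. It is used below to turn expressions in local coordinates which do
  not depend on the coordinate system into functions on the manifold.\<close>

definition chart_at :: "('m, 'e) chart set \<Rightarrow> 'm \<Rightarrow> ('m, 'e) chart" where
  "chart_at A p = (SOME c. c \<in> charts_at A p)"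


subsection \<open>Tangent vectors and vector fields\<close>

text \<open>A tangent vector at \<open>p\<close> assigns to each chart around \<open>p\<close> its tuple of components, and these
  tuples are related by the Jacobians of the coordinate changes. The atlas need not be maximal
  here.\<close>

type_synonym ('m, 'e) tvec = "('m, 'e) chart \<Rightarrow> 'e"

definition tangent_space :: "('m, 'e::euclidean_space) chart set \<Rightarrow> 'm \<Rightarrow> ('m, 'e) tvec set" where
  "tangent_space A p = {v \<in> extensional (charts_at A p).
     \<forall>c\<in>charts_at A p. \<forall>c'\<in>charts_at A p.
       v c' = frechet_derivative (transition c c') (at (snd c p)) (v c)}"

definition smooth_vector_field ::
  "('m, 'e::euclidean_space) chart set \<Rightarrow> ('m \<Rightarrow> ('m, 'e) tvec) \<Rightarrow> bool" where
  "smooth_vector_field A W \<longleftrightarrow>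
     (\<forall>p\<in>\<Union> (fst ` A). W p \<in> tangent_space A p) \<and>
     (\<forall>c\<in>A. smooth_on (chart_image c) (\<lambda>x. W (chart_inv c x) c))"

text \<open>The coordinate vector field \<open>\<partial>/\<partial>x\<^sup>j\<close> of the chart \<open>c\<close>, at the point \<open>p\<close>.\<close>

definition coord_vector ::
  "('m, real^'n) chart set \<Rightarrow> ('m, real^'n) chart \<Rightarrow> 'n \<Rightarrow> 'm \<Rightarrow> ('m, real^'n) tvec" where
  "coord_vector A c j p =
     restrict (\<lambda>c'. frechet_derivative (transition c c') (at (snd c p)) (axis j 1)) (charts_at A p)"


subsection \<open>The slit tangent bundle\<close>

definition slit_tangent_bundle ::
  "('m, 'e::euclidean_space) chart set \<Rightarrow> ('m \<times> ('m, 'e) tvec) set" where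
  "slit_tangent_bundle A =
     {(p, v). p \<in> \<Union> (fst ` A) \<and> v \<in> tangent_space A p \<and> (\<forall>c\<in>charts_at A p. v c \<noteq> 0)}"

text \<open>The induced coordinates \<open>(x, y)\<close> on the slit tangent bundle. The charts obtained in this way
  form its (non-maximal) standard atlas; tangent vectors and smoothness on the slit tangent bundle
  are taken with respect to it.\<close>

definition slit_chart ::
  "('m, 'e::euclidean_space) chart set \<Rightarrow> ('m, 'e) chart \<Rightarrow> ('m \<times> ('m, 'e) tvec, 'e \<times> 'e) chart"
where
  "slit_chart A c =
     ({q \<in> slit_tangent_bundle A. fst q \<in> fst c}, \<lambda>q. (snd c (fst q), snd q c))"

definition slit_atlas ::
  "('m, 'e::euclidean_space) chart set \<Rightarrow> ('m \<times> ('m, 'e) tvec, 'e \<times> 'e) chart set" where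
  "slit_atlas A = slit_chart A ` A"

type_synonym ('m, 'e) slit_field =
  "'m \<times> ('m, 'e) tvec \<Rightarrow> ('m \<times> ('m, 'e) tvec, 'e \<times> 'e) tvec"


subsection \<open>Sprays\<close>

text \<open>The coefficients \<open>G\<^sup>i(x, y)\<close> in the chart \<open>c\<close>: the \<open>\<partial>/\<partial>y\<^sup>i\<close>-component of the field
  is \<open>- 2 G\<^sup>i\<close>.\<close>

definition spray_coeff ::
  "('m, 'e::euclidean_space) chart set \<Rightarrow> ('m, 'e) slit_field \<Rightarrow> ('m, 'e) chart \<Rightarrow> 'e \<times> 'e \<Rightarrow> 'e"
where
  "spray_coeff A G c z =
     - (1/2) *\<^sub>R snd (G (chart_inv (slit_chart A c) z) (slit_chart A c))"

definition spray :: "('m, 'e::euclidean_space) chart set \<Rightarrow> ('m, 'e) slit_field \<Rightarrow> bool" where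
  "spray A G \<longleftrightarrow>
     smooth_vector_field (slit_atlas A) G \<and>
     (\<forall>c\<in>A. \<forall>(x, y)\<in>chart_image (slit_chart A c).
        G (chart_inv (slit_chart A c) (x, y)) (slit_chart A c)
          = (y, - 2 *\<^sub>R spray_coeff A G c (x, y)) \<and>
        (\<forall>t>0. spray_coeff A G c (x, t *\<^sub>R y) = t\<^sup>2 *\<^sub>R spray_coeff A G c (x, y)))"

definition pdx :: "'n \<Rightarrow> ((real^'n) \<times> (real^'n) \<Rightarrow> real) \<Rightarrow> (real^'n) \<times> (real^'n) \<Rightarrow> real" where
  "pdx k f z = frechet_derivative f (at z) (axis k 1, 0)"

definition pdy :: "'n \<Rightarrow> ((real^'n) \<times> (real^'n) \<Rightarrow> real) \<Rightarrow> (real^'n) \<times> (real^'n) \<Rightarrow> real" where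
  "pdy k f z = frechet_derivative f (at z) (0, axis k 1)"

text \<open>The component \<open>R\<^sup>i\<^sub>k\<close> of the Riemann curvature in local coordinates, in terms of the
  coefficients \<open>F\<close> of the spray.\<close>

definition riemann_coord ::
  "((real^'n) \<times> (real^'n) \<Rightarrow> real^'n) \<Rightarrow> 'n \<Rightarrow> 'n \<Rightarrow> (real^'n) \<times> (real^'n) \<Rightarrow> real" where
  "riemann_coord F i k z =
     2 * pdx k (\<lambda>w. F w $ i) z
     - (\<Sum>j\<in>UNIV. snd z $ j * pdx j (pdy k (\<lambda>w. F w $ i)) z)
     + 2 * (\<Sum>j\<in>UNIV. F z $ j * pdy j (pdy k (\<lambda>w. F w $ i)) z)
     - (\<Sum>s\<in>UNIV. pdy s (\<lambda>w. F w $ i) z * pdy k (\<lambda>w. F w $ s) z)"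

definition Ric ::
  "('m, real^'n) chart set \<Rightarrow> ('m, real^'n) slit_field \<Rightarrow> 'm \<times> ('m, real^'n) tvec \<Rightarrow> real" where
  "Ric A G q = (let c = chart_at A (fst q) in
     \<Sum>m\<in>UNIV. riemann_coord (spray_coeff A G c) m m (snd (slit_chart A c) q))"


subsection \<open>Volume forms, S-curvature and projective Ricci curvature\<close>

text \<open>Volume forms are positive densities, so that \<open>\<sigma> > 0\<close> makes sense in every local coordinate
  system and \<open>M\<close> need not be orientable: \<open>dV\<close> at \<open>p\<close> maps an \<open>n\<close>-tuple of tangent vectors to the
  volume of the parallelepiped it spans. The coefficient \<open>\<sigma>\<close> in the chart \<open>c\<close> is the value on
  the coordinate frame, and the last clause below says \<open>dV = \<sigma> dx\<^sup>1 \<dots> dx\<^sup>n\<close>.\<close>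

type_synonym ('m, 'n) vol = "'m \<Rightarrow> ('n \<Rightarrow> ('m, real^'n) tvec) \<Rightarrow> real"

definition vol_coeff ::
  "('m, real^'n) chart set \<Rightarrow> ('m, 'n) vol \<Rightarrow> ('m, real^'n) chart \<Rightarrow> real^'n \<Rightarrow> real" where
  "vol_coeff A dV c x = dV (chart_inv c x) (\<lambda>j. coord_vector A c j (chart_inv c x))"

definition volume_form :: "('m, real^'n) chart set \<Rightarrow> ('m, 'n) vol \<Rightarrow> bool" where
  "volume_form A dV \<longleftrightarrow> (\<forall>c\<in>A.
     smooth_on (chart_image c) (vol_coeff A dV c) \<and>
     (\<forall>x\<in>chart_image c. vol_coeff A dV c x > 0) \<and>
     (\<forall>p\<in>fst c. \<forall>v. (\<forall>j. v j \<in> tangent_space A p) \<longrightarrow>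
        dV p v = vol_coeff A dV c (snd c p) * \<bar>det (\<chi> i j. v j c $ i)\<bar>))"

definition S_curvature ::
  "('m, real^'n) chart set \<Rightarrow> ('m, real^'n) slit_field \<Rightarrow> ('m, 'n) vol \<Rightarrow>
   'm \<times> ('m, real^'n) tvec \<Rightarrow> real" where
  "S_curvature A G dV q = (let c = chart_at A (fst q); (x, y) = snd (slit_chart A c) q in
     (\<Sum>m\<in>UNIV. pdy m (\<lambda>w. spray_coeff A G c w $ m) (x, y))
     - (\<Sum>m\<in>UNIV. y $ m *
          frechet_derivative (\<lambda>u. ln (vol_coeff A dV c u)) (at x) (axis m 1)))"

text \<open>\<open>\<phi>\<^sub>0 = \<phi>\<^bsub>x\<^sup>m\<^esub> y\<^sup>m\<close> for a scalar function \<open>\<phi>\<close> on \<open>M\<close>.\<close>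

definition scalar_0 ::
  "('m, real^'n) chart set \<Rightarrow> ('m \<Rightarrow> real) \<Rightarrow> 'm \<times> ('m, real^'n) tvec \<Rightarrow> real" where
  "scalar_0 A f q = (let c = chart_at A (fst q); (x, y) = snd (slit_chart A c) q in
     \<Sum>m\<in>UNIV. frechet_derivative (f \<circ> chart_inv c) (at x) (axis m 1) * y $ m)"

text \<open>\<open>Y = y\<^sup>i \<partial>/\<partial>y\<^sup>i\<close>, with components \<open>(0, y)\<close> in induced coordinates.\<close>

definition liouville_field :: "('m, 'e::euclidean_space) chart set \<Rightarrow> ('m, 'e) slit_field" where
  "liouville_field A q = restrict (\<lambda>b. (0, snd (snd b q))) (charts_at (slit_atlas A) q)"

definition projective_spray ::
  "('m, real^'n) chart set \<Rightarrow> ('m, real^'n) slit_field \<Rightarrow> ('m, 'n) vol \<Rightarrow>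
   ('m, real^'n) slit_field" where
  "projective_spray A G dV q = restrict
     (\<lambda>b. G q b + (2 * S_curvature A G dV q / (real CARD('n) + 1)) *\<^sub>R liouville_field A q b)
     (charts_at (slit_atlas A) q)"

definition PRic ::
  "('m, real^'n) chart set \<Rightarrow> ('m, real^'n) slit_field \<Rightarrow> ('m, 'n) vol \<Rightarrow>
   'm \<times> ('m, real^'n) tvec \<Rightarrow> real" where
  "PRic A G dV = Ric A (projective_spray A G dV)"

definition projectively_Ricci_flat ::
  "('m, real^'n) chart set \<Rightarrow> ('m, real^'n) slit_field \<Rightarrow> bool" where
  "projectively_Ricci_flat A G \<longleftrightarrow>
     (\<exists>dV. volume_form A dV \<and> (\<forall>q\<in>slit_tangent_bundle A. PRic A G dV q = 0))"

end

theory Submission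
  imports Defs
begin

text \<open>
  Adding \<open>(n + 1) \<phi>\<close> to \<open>ln \<sigma>\<close> lowers the S-curvature by \<open>(n + 1) \<phi>\<^sub>0\<close>, because \<open>\<sigma>\<close> enters
  it only through \<open>y\<^sup>m \<partial>\<^sub>m (ln \<sigma>)\<close>. So the volume form \<open>exp ((n + 1) \<phi>) dV\<close>
  (\<open>volume_form_exp_scale\<close>) has vanishing S-curvature (\<open>S_curvature_exp_scale\<close>). The
  projective spray with respect to it is therefore \<open>\<^bold>G\<close> itself, and its projective Ricci curvature
  is \<open>Ric\<close>, which vanishes by assumption.

  Two analytic points remain. That the rescaled volume form is smooth rests on the closure of
  \<open>C\<^sup>k\<close> functions under products and exponentials. That two sprays agreeing on the slit tangent
  bundle have the same Ricci curvature (\<open>Ric_cong\<close>) rests on the induced charts of the bundle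
  having open image: the curvature is built from derivatives of the coefficients in a chart, and
  these see a whole neighbourhood. The image is \<open>U \<times> (\<real>\<^sup>n - {0})\<close>, with \<open>U\<close> the image of the
  underlying chart (\<open>slit_chart_image\<close>): the chain rule for coordinate changes
  (\<open>transition_deriv_trans\<close>) shows that every nonzero tuple of components at a point extends to a
  tangent vector.
\<close>


section \<open>Smooth functions\<close>

lemma frechet_derivative_cong_open:
  assumes "open S" "x \<in> S" "\<And>u. u \<in> S \<Longrightarrow> f u = g u"
  shows "frechet_derivative f (at x) = frechet_derivative g (at x)"
proof -
  have "(f has_derivative D) (at x) \<longleftrightarrow> (g has_derivative D) (at x)" for D
    using assms has_derivative_transform_within_open by (metis (no_types, lifting))
  then show ?thesis
    by (simp add: frechet_derivative_def)
qed

lemma differentiable_cong_open: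
  assumes "open S" "x \<in> S" "\<And>u. u \<in> S \<Longrightarrow> f u = g u"
  shows "f differentiable (at x) \<longleftrightarrow> g differentiable (at x)"
  using assms has_derivative_transform_within_open unfolding differentiable_def
  by (metis (no_types, lifting))

lemma Ck_on_cong:
  assumes "open S" "\<And>u. u \<in> S \<Longrightarrow> f u = g u"
  shows "Ck_on k S f \<longleftrightarrow> Ck_on k S g"
  using assms(2)
proof (induction k arbitrary: f g)
  case 0
  then show ?case by (simp cong: continuous_on_cong)
next
  case (Suc k)
  have "Ck_on k S (\<lambda>x. frechet_derivative f (at x) v) \<longleftrightarrow>
        Ck_on k S (\<lambda>x. frechet_derivative g (at x) v)" for v
    by (rule Suc.IH)
      (metis frechet_derivative_cong_open[OF assms(1)] Suc.prems)
  moreover have "\<forall>x\<in>S. f differentiable (at x) \<longleftrightarrow> g differentiable (at x)"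
    using differentiable_cong_open[OF assms(1)] Suc.prems by blast
  ultimately show ?case by auto
qed

lemma Ck_on_Suc_imp: "Ck_on (Suc k) S f \<Longrightarrow> Ck_on k S f"
proof (induction k arbitrary: f)
  case 0
  then show ?case
    by (auto intro!: continuous_at_imp_continuous_on differentiable_imp_continuous_within)
next
  case (Suc k)
  then show ?case by (metis Ck_on.simps(2))
qed

lemma Ck_on_add:
  assumes "open S" "Ck_on k S f" "Ck_on k S g"
  shows "Ck_on k S (\<lambda>x. f x + g x)"
  using assms(2,3)
proof (induction k arbitrary: f g)
  case 0
  then show ?case by (simp add: continuous_on_add)
next
  case (Suc k)
  have "frechet_derivative (\<lambda>x. f x + g x) (at x) v
      = frechet_derivative f (at x) v + frechet_derivative g (at x) v" if "x \<in> S" for x v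
  proof -
    have "((\<lambda>x. f x + g x) has_derivative
        (\<lambda>h. frechet_derivative f (at x) h + frechet_derivative g (at x) h)) (at x)"
      using Suc.prems that
      by (intro has_derivative_add) (auto simp: frechet_derivative_works[symmetric])
    from frechet_derivative_at[OF this, symmetric] show ?thesis by simp
  qed
  then have "Ck_on k S (\<lambda>x. frechet_derivative (\<lambda>x. f x + g x) (at x) v)" for v
    by (subst Ck_on_cong[OF assms(1)]) (use Suc in auto)
  then show ?case using Suc.prems by (auto intro: differentiable_add)
qed

lemma Ck_on_mult:
  fixes f g :: "'a::real_normed_vector \<Rightarrow> 'b::real_normed_algebra"
  assumes "open S" "Ck_on k S f" "Ck_on k S g"
  shows "Ck_on k S (\<lambda>x. f x * g x)"
  using assms(2,3)
proof (induction k arbitrary: f g)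
  case 0
  then show ?case by (simp add: continuous_on_mult)
next
  case (Suc k)
  have D: "((\<lambda>x. f x * g x) has_derivative
        (\<lambda>h. f x * frechet_derivative g (at x) h + frechet_derivative f (at x) h * g x)) (at x)"
    if "x \<in> S" for x
    using Suc.prems that
    by (intro has_derivative_mult) (auto simp: frechet_derivative_works[symmetric])
  have "Ck_on k S f" "Ck_on k S g"
    using Suc.prems Ck_on_Suc_imp by blast+
  then have "Ck_on k S (\<lambda>x. frechet_derivative (\<lambda>x. f x * g x) (at x) v)" for v
    by (subst Ck_on_cong[OF assms(1), where g =
          "\<lambda>x. f x * frechet_derivative g (at x) v + frechet_derivative f (at x) v * g x"])
      (use Suc frechet_derivative_at[OF D, symmetric] in \<open>auto intro!: Ck_on_add[OF assms(1)]\<close>)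
  then show ?case using D by (auto simp: differentiable_def)
qed

lemma Ck_on_const: "Ck_on k S (\<lambda>x. c)"
  by (induction k arbitrary: c) auto

text \<open>The derivative of \<open>exp \<circ> f\<close> is \<open>exp \<circ> f\<close> times that of \<open>f\<close>. So if \<open>exp \<circ> f\<close> is of class
  \<open>C\<^sup>k\<close>, its derivatives are as well, being products, and it is of class \<open>C\<^sup>k\<^sup>+\<^sup>1\<close>.\<close>

lemma Ck_on_exp:
  fixes f :: "'a::real_normed_vector \<Rightarrow> real"
  assumes "open S" "Ck_on k S f"
  shows "Ck_on k S (\<lambda>x. exp (f x))"
  using assms(2)
proof (induction k)
  case 0
  then show ?case by (simp add: continuous_on_exp)
next
  case (Suc k)
  have D: "((\<lambda>x. exp (f x)) has_derivative (\<lambda>h. exp (f x) * frechet_derivative f (at x) h)) (at x)"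
    if "x \<in> S" for x
  proof -
    have "(f has_derivative frechet_derivative f (at x)) (at x)"
      using Suc.prems that by (auto simp: frechet_derivative_works[symmetric])
    from has_derivative_exp[OF this] show ?thesis by (simp add: mult.commute)
  qed
  have "Ck_on k S (\<lambda>x. exp (f x))"
    using Suc Ck_on_Suc_imp by blast
  then have "Ck_on k S (\<lambda>x. frechet_derivative (\<lambda>x. exp (f x)) (at x) v)" for v
    by (subst Ck_on_cong[OF assms(1), where g = "\<lambda>x. exp (f x) * frechet_derivative f (at x) v"])
      (use Suc.prems frechet_derivative_at[OF D, symmetric] in
        \<open>auto intro!: Ck_on_mult[OF assms(1)]\<close>)
  then show ?case using D by (auto simp: differentiable_def)
qed

lemma smooth_on_imp_differentiable:
  assumes "smooth_on S f" "x \<in> S"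
  shows "f differentiable (at x)"
  using assms Ck_on.simps(2) unfolding smooth_on_def by blast


section \<open>Charts and tangent vectors\<close>

lemma chart_at_fst_in:
  assumes "q \<in> slit_tangent_bundle A"
  shows "chart_at A (fst q) \<in> A" "fst q \<in> fst (chart_at A (fst q))"
proof -
  have "fst q \<in> \<Union> (fst ` A)"
    using assms unfolding slit_tangent_bundle_def by (metis (lifting) case_prod_beta mem_Collect_eq)
  then have "charts_at A (fst q) \<noteq> {}"
    unfolding charts_at_def by blast
  then have "chart_at A (fst q) \<in> charts_at A (fst q)"
    unfolding chart_at_def by (simp add: some_in_eq)
  then show "chart_at A (fst q) \<in> A" "fst q \<in> fst (chart_at A (fst q))"
    by (auto simp: charts_at_def)
qed

lemma chart_inv_left:
  assumes "is_chart X c" "p \<in> fst c"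
  shows "chart_inv c (snd c p) = p"
proof -
  have "openin X (fst c)"
    using assms(1) by (simp add: is_chart_def)
  then have "topspace (subtopology X (fst c)) = fst c"
    using openin_subset by fastforce
  moreover have "inj_on (snd c) (topspace (subtopology X (fst c)))"
    using assms(1) homeomorphic_imp_injective_map unfolding is_chart_def by blast
  ultimately show ?thesis
    using assms(2) by (simp add: inv_into_f_f)
qed

lemma open_chart_image_Int:
  assumes "is_chart X c" "openin X U"
  shows "open (snd c ` (fst c \<inter> U))"
proof -
  have hom: "homeomorphic_map (subtopology X (fst c)) (top_of_set (chart_image c)) (snd c)"
    and "open (chart_image c)"
    using assms(1) by (auto simp: is_chart_def)
  have "openin (subtopology X (fst c)) (fst c \<inter> U)"
    using assms(2) by (auto simp: openin_subtopology)
  then have "openin (top_of_set (chart_image c)) (snd c ` (fst c \<inter> U))"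
    using homeomorphic_imp_open_map[OF hom] by (auto simp: open_map_def)
  with \<open>open (chart_image c)\<close> show ?thesis
    using openin_open_trans by blast
qed

lemma transition_has_derivative:
  assumes "smooth_manifold X A" "c \<in> A" "c' \<in> A" "p \<in> fst c" "p \<in> fst c'"
  shows "(transition c c' has_derivative frechet_derivative (transition c c') (at (snd c p)))
           (at (snd c p))"
proof -
  have "smooth_on (snd c ` (fst c \<inter> fst c')) (transition c c')"
    using assms(1-3) by (auto simp: smooth_manifold_def smoothly_compatible_def)
  then show ?thesis
    using assms(4,5) smooth_on_imp_differentiable frechet_derivative_works
    by (metis IntI imageI)
qed

text \<open>The cocycle condition of the tangent bundle. It is the chain rule for
  \<open>transition c c'' = transition c' c'' \<circ> transition c c'\<close>, an identity which holds only where the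
  chart \<open>c'\<close> is defined; that domain has open image under \<open>c\<close>, which is what derivatives need.\<close>

lemma transition_deriv_trans:
  assumes M: "smooth_manifold X A"
    and A: "c \<in> A" "c' \<in> A" "c'' \<in> A" and p: "p \<in> fst c" "p \<in> fst c'" "p \<in> fst c''"
  shows "frechet_derivative (transition c' c'') (at (snd c' p))
           (frechet_derivative (transition c c') (at (snd c p)) y)
         = frechet_derivative (transition c c'') (at (snd c p)) y"
proof -
  have charts: "is_chart X c" "is_chart X c'"
    using M A by (auto simp: smooth_manifold_def)
  have at_p: "transition c c' (snd c p) = snd c' p"
    using chart_inv_left[OF charts(1) p(1)] by (simp add: transition_def)
  have "((transition c' c'' \<circ> transition c c') has_derivative
      frechet_derivative (transition c' c'') (at (snd c' p)) \<circ>
      frechet_derivative (transition c c') (at (snd c p))) (at (snd c p))"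
    using transition_has_derivative[OF M A(1,2) p(1,2)]
      transition_has_derivative[OF M A(2,3) p(2,3)]
    by (intro diff_chain_at) (simp_all add: at_p)
  then have "(transition c c'' has_derivative
      frechet_derivative (transition c' c'') (at (snd c' p)) \<circ>
      frechet_derivative (transition c c') (at (snd c p))) (at (snd c p))"
  proof (rule has_derivative_transform_within_open)
    show "open (snd c ` (fst c \<inter> fst c'))"
      using open_chart_image_Int[OF charts(1)] charts(2) by (simp add: is_chart_def)
    show "snd c p \<in> snd c ` (fst c \<inter> fst c')"
      using p by auto
    show "(transition c' c'' \<circ> transition c c') u = transition c c'' u"
      if "u \<in> snd c ` (fst c \<inter> fst c')" for u
      using that chart_inv_left[OF charts(1)] chart_inv_left[OF charts(2)]
      by (auto simp: transition_def)
  qed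
  from frechet_derivative_at[OF this] show ?thesis
    by (metis comp_apply)
qed

lemma transition_deriv_self:
  assumes M: "smooth_manifold X A" and A: "c \<in> A" and p: "p \<in> fst c"
  shows "frechet_derivative (transition c c) (at (snd c p)) y = y"
proof -
  have c: "is_chart X c"
    using M A by (auto simp: smooth_manifold_def)
  have "frechet_derivative (transition c c) (at (snd c p))
      = frechet_derivative (\<lambda>u. u) (at (snd c p))"
  proof (rule frechet_derivative_cong_open)
    show "open (chart_image c)"
      using c by (simp add: is_chart_def)
    show "transition c c u = u" if "u \<in> chart_image c" for u
      using that by (simp add: transition_def f_inv_into_f)
  qed (use p in auto)
  then show ?thesis by simp
qed

text \<open>A component tuple \<open>y \<noteq> 0\<close> in the chart \<open>c\<close> is pushed to all other charts by the Jacobians;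
  the cocycle condition makes this a tangent vector, and makes its components nonzero since they are
  sent back to \<open>y\<close> by a linear map.\<close>

lemma slit_chart_image:
  fixes A :: "('m, 'e::euclidean_space) chart set"
  assumes M: "smooth_manifold X A" and A: "c \<in> A"
  shows "chart_image (slit_chart A c) = chart_image c \<times> (- {0})"
proof (intro equalityI subsetI)
  fix z assume "z \<in> chart_image (slit_chart A c)"
  then show "z \<in> chart_image c \<times> (- {0})"
    using A by (cases c) (auto simp: slit_chart_def slit_tangent_bundle_def charts_at_def)
next
  fix z :: "'e \<times> 'e" assume "z \<in> chart_image c \<times> (- {0})"
  then obtain p y where z: "z = (snd c p, y)" and p: "p \<in> fst c" and y: "y \<noteq> 0"
    by auto
  define v where "v = restrict (\<lambda>c'. frechet_derivative (transition c c') (at (snd c p)) y)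
    (charts_at A p)"
  have v: "v c' = frechet_derivative (transition c c') (at (snd c p)) y"
    if "c' \<in> charts_at A p" for c'
    using that by (simp add: v_def)
  have cocycle: "v c'' = frechet_derivative (transition c' c'') (at (snd c' p)) (v c')"
    if "c' \<in> charts_at A p" "c'' \<in> charts_at A p" for c' c''
    unfolding v[OF that(1)] v[OF that(2)]
    using that p by (intro transition_deriv_trans[OF M A, symmetric]) (auto simp: charts_at_def)
  have "v \<in> extensional (charts_at A p)"
    by (simp add: v_def)
  with cocycle have tangent: "v \<in> tangent_space A p"
    unfolding tangent_space_def by blast
  have cp: "c \<in> charts_at A p"
    using A p by (simp add: charts_at_def)
  have vc: "v c = y"
    using v[OF cp] transition_deriv_self[OF M A p] by simp
  have "v c' \<noteq> 0" if c': "c' \<in> charts_at A p" for c'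
  proof
    assume 0: "v c' = 0"
    have "y = frechet_derivative (transition c' c) (at (snd c' p)) (v c')"
      using cocycle[OF c' cp] unfolding vc .
    also have "\<dots> = 0"
    proof -
      have "linear (frechet_derivative (transition c' c) (at (snd c' p)))"
        using transition_has_derivative[OF M _ A _ p, of c'] c' has_derivative_linear
        unfolding charts_at_def by blast
      then show ?thesis by (simp add: 0 linear_0)
    qed
    finally show False using y by simp
  qed
  then have "(p, v) \<in> fst (slit_chart A c)"
    using tangent A p by (auto simp: slit_chart_def slit_tangent_bundle_def)
  moreover have "snd (slit_chart A c) (p, v) = z"
    by (simp add: slit_chart_def z vc)
  ultimately show "z \<in> chart_image (slit_chart A c)"
    by (rule image_eqI[OF sym, rotated])
qed

lemma open_slit_chart_image:
  assumes "smooth_manifold X A" "c \<in> A"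
  shows "open (chart_image (slit_chart A c))"
  unfolding slit_chart_image[OF assms] using assms
  by (intro open_Times) (auto simp: smooth_manifold_def is_chart_def)


section \<open>Ricci curvature depends on the spray over the slit tangent bundle only\<close>

lemma pdx_cong_open:
  assumes "open S" "z \<in> S" "\<And>w. w \<in> S \<Longrightarrow> f w = g w"
  shows "pdx k f z = pdx k g z"
  unfolding pdx_def using frechet_derivative_cong_open[OF assms] by simp

lemma pdy_cong_open:
  assumes "open S" "z \<in> S" "\<And>w. w \<in> S \<Longrightarrow> f w = g w"
  shows "pdy k f z = pdy k g z"
  unfolding pdy_def using frechet_derivative_cong_open[OF assms] by simp

lemma riemann_coord_cong_open:
  assumes "open S" "z \<in> S" and eq: "\<And>w. w \<in> S \<Longrightarrow> F w = H w"
  shows "riemann_coord F i k z = riemann_coord H i k z"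
proof -
  have y: "pdy j (\<lambda>w. F w $ l) u = pdy j (\<lambda>w. H w $ l) u" if "u \<in> S" for j l u
    using that eq by (intro pdy_cong_open[OF assms(1)]) auto
  have x: "pdx j (\<lambda>w. F w $ l) z = pdx j (\<lambda>w. H w $ l) z" for j l
    using eq by (intro pdx_cong_open[OF assms(1,2)]) auto
  have xy: "pdx j (pdy l (\<lambda>w. F w $ i)) z = pdx j (pdy l (\<lambda>w. H w $ i)) z" for j l
    using y by (intro pdx_cong_open[OF assms(1,2)])
  have yy: "pdy j (pdy l (\<lambda>w. F w $ i)) z = pdy j (pdy l (\<lambda>w. H w $ i)) z" for j l
    using y by (intro pdy_cong_open[OF assms(1,2)])
  show ?thesis
    unfolding riemann_coord_def by (simp add: x xy yy y[OF assms(2)] eq[OF assms(2)])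
qed

lemma Ric_cong:
  assumes M: "smooth_manifold X A" and q: "q \<in> slit_tangent_bundle A"
    and eq: "\<And>r b. r \<in> slit_tangent_bundle A \<Longrightarrow> b \<in> charts_at (slit_atlas A) r \<Longrightarrow> G r b = H r b"
  shows "Ric A G q = Ric A H q"
proof -
  define c where "c = chart_at A (fst q)"
  from chart_at_fst_in[OF q] have c: "c \<in> A" "fst q \<in> fst c"
    by (simp_all add: c_def)
  have coeff: "spray_coeff A G c w = spray_coeff A H c w"
    if "w \<in> chart_image (slit_chart A c)" for w
  proof -
    let ?r = "chart_inv (slit_chart A c) w"
    have r: "?r \<in> fst (slit_chart A c)"
      using that by (rule inv_into_into)
    then have "?r \<in> slit_tangent_bundle A"
      by (simp add: slit_chart_def)
    moreover have "slit_chart A c \<in> charts_at (slit_atlas A) ?r"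
      using c(1) r by (simp add: charts_at_def slit_atlas_def)
    ultimately show ?thesis
      unfolding spray_coeff_def by (simp add: eq)
  qed
  have "snd (slit_chart A c) q \<in> chart_image (slit_chart A c)"
    using q c(2) by (intro imageI) (simp add: slit_chart_def)
  then have "riemann_coord (spray_coeff A G c) m m (snd (slit_chart A c) q)
      = riemann_coord (spray_coeff A H c) m m (snd (slit_chart A c) q)" for m
    using riemann_coord_cong_open[OF open_slit_chart_image[OF M c(1)]] coeff by blast
  then show ?thesis
    unfolding Ric_def Let_def c_def[symmetric] by simp
qed

text \<open>The projective spray then has the components of \<open>G\<close> at every point of the slit tangent bundle
  and in every chart there. Elsewhere the two fields may differ, so equality of the curvatures comes
  from \<open>Ric_cong\<close> and not from equality of the fields.\<close>

lemma PRic_eq_Ric_if_S_curvature_zero: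
  assumes "smooth_manifold X A" "q \<in> slit_tangent_bundle A"
    and "\<And>r. r \<in> slit_tangent_bundle A \<Longrightarrow> S_curvature A G dV r = 0"
  shows "PRic A G dV q = Ric A G q"
  unfolding PRic_def
  by (rule Ric_cong[OF assms(1,2)]) (simp add: projective_spray_def assms(3))


section \<open>Rescaling the volume form\<close>

definition exp_scale :: "('m \<Rightarrow> real) \<Rightarrow> ('m, 'n) vol \<Rightarrow> ('m, 'n::finite) vol" where
  "exp_scale f dV p v = exp (f p) * dV p v"

lemma vol_coeff_exp_scale:
  "vol_coeff A (exp_scale f dV) c x = exp (f (chart_inv c x)) * vol_coeff A dV c x"
  by (simp add: vol_coeff_def exp_scale_def)

lemma smooth_scalar_cmult:
  assumes M: "smooth_manifold X A" and f: "smooth_scalar A f"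
  shows "smooth_scalar A (\<lambda>p. a * f p)"
proof -
  have "Ck_on k (chart_image c) (\<lambda>x. a * f (chart_inv c x))" if "c \<in> A" for c k
  proof (rule Ck_on_mult[OF _ Ck_on_const])
    show "open (chart_image c)"
      using M that by (auto simp: smooth_manifold_def is_chart_def)
    show "Ck_on k (chart_image c) (\<lambda>x. f (chart_inv c x))"
      using f that by (simp add: smooth_scalar_def smooth_on_def comp_def)
  qed
  then show ?thesis
    by (simp add: smooth_scalar_def smooth_on_def comp_def)
qed

lemma volume_form_exp_scale:
  assumes M: "smooth_manifold X A" and V: "volume_form A dV" and f: "smooth_scalar A f"
  shows "volume_form A (exp_scale f dV)"
  unfolding volume_form_def
proof (intro ballI conjI allI impI)
  fix c assume c: "c \<in> A"
  have chart: "is_chart X c"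
    using M c by (auto simp: smooth_manifold_def)
  then have op: "open (chart_image c)"
    by (simp add: is_chart_def)
  have "Ck_on k (chart_image c) (\<lambda>x. exp (f (chart_inv c x)) * vol_coeff A dV c x)" for k
  proof (intro Ck_on_mult[OF op] Ck_on_exp[OF op])
    show "Ck_on k (chart_image c) (\<lambda>x. f (chart_inv c x))"
      using f c by (simp add: smooth_scalar_def smooth_on_def comp_def)
    show "Ck_on k (chart_image c) (vol_coeff A dV c)"
      using V c by (simp add: volume_form_def smooth_on_def)
  qed
  then show "smooth_on (chart_image c) (vol_coeff A (exp_scale f dV) c)"
    unfolding smooth_on_def vol_coeff_exp_scale by blast
  show "vol_coeff A (exp_scale f dV) c x > 0" if "x \<in> chart_image c" for x
    using V c that unfolding vol_coeff_exp_scale volume_form_def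
    by (blast intro: mult_pos_pos exp_gt_zero)
  show "exp_scale f dV p v = vol_coeff A (exp_scale f dV) c (snd c p) * \<bar>det (\<chi> i j. v j c $ i)\<bar>"
    if "p \<in> fst c" "\<forall>j. v j \<in> tangent_space A p" for p v
  proof -
    have "dV p v = vol_coeff A dV c (snd c p) * \<bar>det (\<chi> i j. v j c $ i)\<bar>"
      using V c that by (simp add: volume_form_def)
    then show ?thesis
      by (simp add: vol_coeff_exp_scale exp_scale_def chart_inv_left[OF chart that(1)])
  qed
qed

text \<open>The logarithm turns the factor \<open>exp f\<close> into the summand \<open>f\<close> of \<open>ln \<sigma>\<close>, whose derivative along
  \<open>y\<close> is \<open>f\<^sub>0\<close>.\<close>

lemma S_curvature_exp_scale:
  assumes M: "smooth_manifold X A" and V: "volume_form A dV" and f: "smooth_scalar A f"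
    and q: "q \<in> slit_tangent_bundle A"
  shows "S_curvature A G (exp_scale f dV) q = S_curvature A G dV q - scalar_0 A f q"
proof -
  define c where "c = chart_at A (fst q)"
  from chart_at_fst_in[OF q] have c: "c \<in> A" "fst q \<in> fst c"
    by (simp_all add: c_def)
  define x where "x = snd c (fst q)"
  have x: "x \<in> chart_image c"
    using c(2) by (simp add: x_def)
  have op: "open (chart_image c)"
    using M c(1) by (auto simp: smooth_manifold_def is_chart_def)
  have pos: "vol_coeff A dV c u > 0" if "u \<in> chart_image c" for u
    using V c(1) that unfolding volume_form_def by blast
  let ?ln = "\<lambda>u. ln (vol_coeff A dV c u)"
  have "(f \<circ> chart_inv c) differentiable (at x)"
    using f c(1) x smooth_on_imp_differentiable unfolding smooth_scalar_def by blast
  moreover have "?ln differentiable (at x)"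
  proof -
    have "vol_coeff A dV c differentiable (at x)"
      using V c(1) x smooth_on_imp_differentiable unfolding volume_form_def by blast
    then show ?thesis
      using has_derivative_ln[where g = "vol_coeff A dV c", OF pos[OF x]]
      unfolding differentiable_def by blast
  qed
  ultimately have "((\<lambda>u. (f \<circ> chart_inv c) u + ?ln u) has_derivative
      (\<lambda>h. frechet_derivative (f \<circ> chart_inv c) (at x) h + frechet_derivative ?ln (at x) h)) (at x)"
    by (intro has_derivative_add) (simp_all only: frechet_derivative_works)
  then have "((\<lambda>u. ln (vol_coeff A (exp_scale f dV) c u)) has_derivative
      (\<lambda>h. frechet_derivative (f \<circ> chart_inv c) (at x) h + frechet_derivative ?ln (at x) h)) (at x)"
    by (rule has_derivative_transform_within_open[OF _ op x])
      (use pos in \<open>auto simp: vol_coeff_exp_scale ln_mult less_imp_neq[symmetric]\<close>)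
  from frechet_derivative_at[OF this, symmetric] show ?thesis
    by (simp add: S_curvature_def scalar_0_def Let_def slit_chart_def c_def[symmetric]
        x_def[symmetric] sum.distrib algebra_simps)
qed

lemma scalar_0_cmult:
  assumes f: "smooth_scalar A f" and q: "q \<in> slit_tangent_bundle A"
  shows "scalar_0 A (\<lambda>p. a * f p) q = a * scalar_0 A f q"
proof -
  define c where "c = chart_at A (fst q)"
  from chart_at_fst_in[OF q] have c: "c \<in> A" "fst q \<in> fst c"
    by (simp_all add: c_def)
  let ?x = "snd c (fst q)"
  have "(f \<circ> chart_inv c) differentiable (at ?x)"
    using f c smooth_on_imp_differentiable unfolding smooth_scalar_def by blast
  then have "((\<lambda>u. a * (f \<circ> chart_inv c) u) has_derivative
      (\<lambda>h. a * frechet_derivative (f \<circ> chart_inv c) (at ?x) h)) (at ?x)"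
    by (intro has_derivative_mult_right) (simp only: frechet_derivative_works)
  from frechet_derivative_at[OF this, symmetric] show ?thesis
    by (simp add: scalar_0_def Let_def slit_chart_def c_def[symmetric] comp_def
        sum_distrib_left mult.assoc)
qed


section \<open>Projective Ricci-flatness\<close>

theorem corollary1p3:
  fixes X :: "'m topology"
    and A :: "('m, real^'n) chart set"
    and G :: "('m, real^'n) slit_field"
    and dV :: "('m, 'n) vol"
    and \<phi> :: "'m \<Rightarrow> real"
  assumes "smooth_manifold X A"
    and "spray A G"
    and "\<And>q. q \<in> slit_tangent_bundle A \<Longrightarrow> Ric A G q = 0"
    and "volume_form A dV"
    and "smooth_scalar A \<phi>"
    and "\<And>q. q \<in> slit_tangent_bundle A \<Longrightarrow>
           S_curvature A G dV q = (real CARD('n) + 1) * scalar_0 A \<phi> q"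
  shows "projectively_Ricci_flat A G"
proof -
  define f where "f = (\<lambda>p. (real CARD('n) + 1) * \<phi> p)"
  have f: "smooth_scalar A f"
    unfolding f_def by (rule smooth_scalar_cmult[OF assms(1,5)])
  have "S_curvature A G (exp_scale f dV) q = 0" if "q \<in> slit_tangent_bundle A" for q
    using S_curvature_exp_scale[OF assms(1,4) f that] scalar_0_cmult[OF assms(5) that]
      assms(6)[OF that]
    by (simp add: f_def)
  then have "PRic A G (exp_scale f dV) q = 0" if "q \<in> slit_tangent_bundle A" for q
    using PRic_eq_Ric_if_S_curvature_zero[OF assms(1) that] assms(3)[OF that] by simp
  with volume_form_exp_scale[OF assms(1,4) f] show ?thesis
    unfolding projectively_Ricci_flat_def by blast
qed

end
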